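(* Let $A$ and $B$ be real diagonal $d\times d$ matrices, and let $P,S$ be independent uniformly random $d\times d$ signed permutation matrices. Then \[ \mathbb{E}_{P,S}\det\!\big(xI-(A+PBS^T)(A+PBS^T)^T\big)=\sum_{k=0}^{d}x^{d-k}(-1)^k\sum_{i+j=k}\left(\frac{(d-i)!\,(d-j)!}{(d-k)!\,d!}\right)^2 e_i(AA^T)\,e_j(BB^T). \]
   Context: A signed permutation matrix is a matrix with entries in $\{0,\pm1\}$ having exactly one nonzero entry in each row and each column; a uniform random one is the product of a diagonal matrix with independent uniform $\pm1$ entries and a uniformly random permutation matrix. For a $d\times d$ matrix $M$, $e_k(M)$ is the sum of its $k\times k$ principal minors (the coefficient of $(-1)^kx^{d-k}$ in $\det(xI-M)$). *)

theory Defs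
  imports
    "HOL-Probability.Probability_Mass_Function"
    "Jordan_Normal_Form.Determinant"
    "Jordan_Normal_Form.DL_Submatrix"
begin

(* det now refers to the determinant on the type of matrices with explicit dimensions. *)
hide_const (open) Determinants.det

definition signed_perm_mats :: "nat \<Rightarrow> real mat set" where
  "signed_perm_mats d = {P \<in> carrier_mat d d.
     (\<forall>i<d. \<forall>j<d. P $$ (i,j) \<in> {0, 1, -1}) \<and>
     (\<forall>i<d. \<exists>!j. j < d \<and> P $$ (i,j) \<noteq> 0) \<and>
     (\<forall>j<d. \<exists>!i. i < d \<and> P $$ (i,j) \<noteq> 0)}"

definition esum_minors :: "nat \<Rightarrow> real mat \<Rightarrow> real" where
  "esum_minors k M = (\<Sum>I | I \<subseteq> {0..<dim_row M} \<and> card I = k. det (submatrix M I I))"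

(* The following two facts ensure that pmf_of_set (signed_perm_mats d) really is the
   uniform distribution. *)
lemma finite_signed_perm_mats: "finite (signed_perm_mats d)"
proof -
  let ?F = "({0..<d} \<times> {0..<d}) \<rightarrow>\<^sub>E {0, 1, -1 :: real}"
  have "signed_perm_mats d \<subseteq> mat d d ` ?F"
  proof
    fix P assume P: "P \<in> signed_perm_mats d"
    let ?f = "restrict (\<lambda>ij. P $$ ij) ({0..<d} \<times> {0..<d})"
    have "P = mat d d ?f"
      using P by (intro eq_matI) (auto simp: signed_perm_mats_def)
    moreover have "?f \<in> ?F"
      using P by (intro restrict_PiE_iff[THEN iffD2]) (simp add: signed_perm_mats_def)
    ultimately show "P \<in> mat d d ` ?F" by blast
  qed
  moreover have "finite (mat d d ` ?F)"
    by (intro finite_imageI finite_PiE) auto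
  ultimately show ?thesis by (rule finite_subset)
qed

lemma signed_perm_mats_nonempty: "signed_perm_mats d \<noteq> {}"
proof -
  have "1\<^sub>m d \<in> signed_perm_mats d" by (auto simp: signed_perm_mats_def split: if_splits)
  then show ?thesis by blast
qed

definition random_signed_perm_mat :: "nat \<Rightarrow> real mat pmf" where
  "random_signed_perm_mat d = pmf_of_set (signed_perm_mats d)"

end

theory Submission
  imports Defs
begin

text \<open>
  Write ' for transposition and C = P B S', and let a, b be the diagonals of A, B. The determinant of
  x I - (A + C)(A + C)' equals that of the 2d x 2d block matrix with rows (x I, A + C) and
  ((A + C)', I), in which each a_i occurs exactly twice, in the rows i and d + i. Flipping the
  signs of rows of P is the same as flipping signs of the a_i, so averaging keeps only the part
  that is even in every a_i: it is the sum over L of (-1)^|L| a_L^2 times the determinant with the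
  rows i and d + i, for i in L, replaced by unit vectors and A removed. Since C is monomial, the
  latter is a product of d - |L| factors, and expanding it gives the sum over W of
  (-1)^|W| x^(d - |L| - |W|) b_W^2 restricted to those W which the permutations underlying P and
  S both map into the complement of L. By independence, the expectation of this
  restriction is the square of the probability that a uniform permutation maps W into the
  complement of L, which is (d - |L|)! (d - |W|)! / ((d - |L| - |W|)! d!).
\<close>

section \<open>Determinants as functions of the rows\<close>

text \<open>Giving the rows as a function turns the replacement of a row into a function update and
  avoids carrier conditions in the multilinear calculations.\<close>

definition row_det :: "nat \<Rightarrow> (nat \<Rightarrow> nat \<Rightarrow> 'a::comm_ring_1) \<Rightarrow> 'a" where
  "row_det n R = det (mat n n (\<lambda>(i, j). R i j))"

lemma row_det_leibniz:
  "row_det n R = (\<Sum>p | p permutes {0..<n}. signof p * (\<Prod>i = 0..<n. R i (p i)))"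
proof -
  have "(\<Prod>i = 0..<n. mat n n (\<lambda>(i, j). R i j) $$ (i, p i)) = (\<Prod>i = 0..<n. R i (p i))"
    if "p permutes {0..<n}" for p
    using that permutes_in_image[OF that] by (intro prod.cong) auto
  then show ?thesis
    unfolding row_det_def by (subst det_def'[of _ n]) (auto intro!: sum.cong)
qed

lemma row_det_cong:
  assumes "\<And>i j. i < n \<Longrightarrow> j < n \<Longrightarrow> R i j = R' i j"
  shows "row_det n R = row_det n R'"
  unfolding row_det_def by (intro arg_cong[of _ _ det] eq_matI) (auto simp: assms)

text \<open>Every Leibniz term contains exactly one entry of row \<open>k\<close>. Splitting it off
  leaves a cofactor free of \<open>u\<close>, which makes linearity in that row immediate.\<close>

lemma row_det_upd:
  assumes "k < n"
  shows "row_det n (R(k := u)) =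
    (\<Sum>p | p permutes {0..<n}. signof p * (u (p k) * (\<Prod>i\<in>{0..<n} - {k}. R i (p i))))"
  unfolding row_det_leibniz
proof (intro sum.cong refl arg_cong2[of _ _ _ _ "(*)"])
  fix p
  have "(\<Prod>i = 0..<n. (R(k := u)) i (p i)) = u (p k) * (\<Prod>i\<in>{0..<n} - {k}. (R(k := u)) i (p i))"
    using assms by (subst prod.remove[of _ k]) auto
  also have "(\<Prod>i\<in>{0..<n} - {k}. (R(k := u)) i (p i)) = (\<Prod>i\<in>{0..<n} - {k}. R i (p i))"
    by (intro prod.cong) auto
  finally show "(\<Prod>i = 0..<n. (R(k := u)) i (p i)) = u (p k) * (\<Prod>i\<in>{0..<n} - {k}. R i (p i))" .
qed

lemma row_det_add_scaled_row:
  assumes "k < n"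
  shows "row_det n (R(k := \<lambda>j. u j + c * v j)) = row_det n (R(k := u)) + c * row_det n (R(k := v))"
  unfolding row_det_upd[OF assms] sum_distrib_left sum.distrib[symmetric]
  by (intro sum.cong refl) (simp add: algebra_simps)

lemma row_det_swap_rows:
  assumes "k < n" "l < n" "k \<noteq> l"
  shows "row_det n (R(k := u, l := v)) = - row_det n (R(k := v, l := u))"
proof -
  have "mat n n (\<lambda>(i, j). (R(k := u, l := v)) i j) =
      swaprows k l (mat n n (\<lambda>(i, j). (R(k := v, l := u)) i j))"
    using assms by (intro eq_matI) auto
  then show ?thesis
    unfolding row_det_def using det_swaprows[OF assms] by (metis mat_carrier)
qed

text \<open>By linearity in the rows \<open>k\<close> and \<open>l\<close>, \<open>F c\<close> is a
  quadratic polynomial in \<open>c\<close>, and the sum with \<open>F (- c)\<close> cancels its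
  linear part. The quadratic coefficient has the unit vectors in crossed position; uncrossing them
  is one row swap, hence the minus sign.\<close>

lemma row_det_symmetric_perturbation:
  fixes R :: "nat \<Rightarrow> nat \<Rightarrow> 'a::comm_ring_1"
  assumes "k < n" "l < n" "k \<noteq> l"
  defines "F \<equiv> \<lambda>c. row_det n (R(k := \<lambda>j. R k j + c * of_bool (j = l),
                               l := \<lambda>j. R l j + c * of_bool (j = k)))"
  shows "F c + F (- c) = 2 * row_det n R
    - 2 * c\<^sup>2 * row_det n (R(k := \<lambda>j. of_bool (j = k), l := \<lambda>j. of_bool (j = l)))"
proof -
  let ?e = "\<lambda>m j. of_bool (j = m) :: 'a"
  have expand: "F c = row_det n R + c * row_det n (R(k := ?e l)) + c * row_det n (R(l := ?e k))
      - c\<^sup>2 * row_det n (R(k := ?e k, l := ?e l))" for c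
  proof -
    have "F c = row_det n (R(k := \<lambda>j. R k j + c * ?e l j, l := R l))
        + c * row_det n (R(k := \<lambda>j. R k j + c * ?e l j, l := ?e k))"
      unfolding F_def by (rule row_det_add_scaled_row[OF assms(2)])
    also have "R(k := \<lambda>j. R k j + c * ?e l j, l := R l) = R(k := \<lambda>j. R k j + c * ?e l j)"
      using assms by (intro ext) auto
    \<comment> \<open>Updates at the distinct rows \<open>k\<close> and \<open>l\<close> commute.
      Bringing the update of row \<open>k\<close> to the outside allows linearity to be applied to
      it next.\<close>
    also have "R(k := \<lambda>j. R k j + c * ?e l j, l := ?e k)
        = (R(l := ?e k))(k := \<lambda>j. R k j + c * ?e l j)"
      using assms by (intro ext) auto
    also have "row_det n (R(k := \<lambda>j. R k j + c * ?e l j))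
        = row_det n (R(k := R k)) + c * row_det n (R(k := ?e l))"
      by (rule row_det_add_scaled_row[OF assms(1)])
    also have "row_det n ((R(l := ?e k))(k := \<lambda>j. R k j + c * ?e l j))
        = row_det n ((R(l := ?e k))(k := R k)) + c * row_det n ((R(l := ?e k))(k := ?e l))"
      by (rule row_det_add_scaled_row[OF assms(1)])
    also have "(R(l := ?e k))(k := R k) = R(l := ?e k)"
      using assms by (intro ext) auto
    also have "(R(l := ?e k))(k := ?e l) = R(k := ?e l, l := ?e k)"
      using assms by (intro ext) auto
    also have "row_det n (R(k := ?e l, l := ?e k)) = - row_det n (R(k := ?e k, l := ?e l))"
      by (rule row_det_swap_rows) (use assms in auto)
    finally show ?thesis
      by (simp add: algebra_simps power2_eq_square del: fun_upd_apply)
  qed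
  show ?thesis
    unfolding expand[of c] expand[of "- c"] by (simp add: algebra_simps del: fun_upd_apply)
qed

lemma row_det_diagonal:
  assumes "\<And>i j. i < n \<Longrightarrow> j < n \<Longrightarrow> i \<noteq> j \<Longrightarrow> R i j = 0"
  shows "row_det n R = (\<Prod>i<n. R i i)"
proof -
  have "row_det n R = prod_list (diag_mat (mat n n (\<lambda>(i, j). R i j)))"
    unfolding row_det_def by (rule det_upper_triangular[where n = n]) (auto simp: assms)
  also have "\<dots> = (\<Prod>i<n. R i i)"
    by (auto simp: diag_mat_def prod.list_conv_set_nth atLeast0LessThan intro!: prod.cong)
  finally show ?thesis .
qed

text \<open>Each Leibniz term picks up every \<open>u i\<close> once from its row and, since
  \<open>p\<close> is a bijection, once from its column.\<close>

lemma row_det_scale_rows_cols: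
  "row_det n (\<lambda>i j. u i * u j * R i j) = (\<Prod>i = 0..<n. u i)\<^sup>2 * row_det n R"
  unfolding row_det_leibniz sum_distrib_left
proof (intro sum.cong refl)
  fix p assume "p \<in> {p. p permutes {0..<n}}"
  then have "(\<Prod>i = 0..<n. u (p i)) = (\<Prod>i = 0..<n. u i)"
    using prod.permute[of p "{0..<n}" u] by (simp add: o_def)
  then show "signof p * (\<Prod>i = 0..<n. u i * u (p i) * R i (p i))
      = (\<Prod>i = 0..<n. u i)\<^sup>2 * (signof p * (\<Prod>i = 0..<n. R i (p i)))"
    by (simp add: prod.distrib power2_eq_square)
qed

section \<open>The bordered block matrix and its dependence on the diagonal entries\<close>

text \<open>
  The block matrix with rows (x I, D + C) and ((D + C)', I), where D is the diagonal matrix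
  with entries a, in which the rows i and d + i with i in K are replaced by unit vectors.
\<close>
definition bordered ::
  "nat \<Rightarrow> 'a \<Rightarrow> (nat \<Rightarrow> nat \<Rightarrow> 'a) \<Rightarrow> (nat \<Rightarrow> 'a) \<Rightarrow> nat set \<Rightarrow> nat \<Rightarrow> nat \<Rightarrow> 'a::comm_ring_1"
where
  "bordered d x C a K r c =
    (if r < d then
       if r \<in> K then of_bool (c = r)
       else if c < d then x * of_bool (c = r)
       else a r * of_bool (c = d + r) + C r (c - d)
     else
       if r - d \<in> K then of_bool (c = r)
       else if c < d then a (r - d) * of_bool (c = r - d) + C c (r - d)
       else of_bool (c = r))"

text \<open>Since \<open>i\<close> is not in \<open>K\<close>, the value \<open>a i\<close> occurs
  exactly at the positions (i, d + i) and (d + i, i). So this is the symmetric perturbation with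
  \<open>k = i\<close>, \<open>l = d + i\<close> and base point \<open>a i = 0\<close>; the two rows
  that become unit vectors are those that \<open>insert i K\<close> prescribes.\<close>

lemma row_det_bordered_even_part:
  assumes "i < d" "i \<notin> K"
  shows "row_det (d + d) (bordered d x C a K) + row_det (d + d) (bordered d x C (a(i := - a i)) K)
    = 2 * row_det (d + d) (bordered d x C (a(i := 0)) K)
      - 2 * (a i)\<^sup>2 * row_det (d + d) (bordered d x C (a(i := 0)) (insert i K))"
proof -
  let ?R = "bordered d x C (a(i := 0)) K"
  let ?F = "\<lambda>c. ?R(i := \<lambda>j. ?R i j + c * of_bool (j = d + i),
                  d + i := \<lambda>j. ?R (d + i) j + c * of_bool (j = i))"
  have upd: "bordered d x C (a(i := c)) K = ?F c" for c
    using assms by (intro ext) (auto simp: bordered_def)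
  have a: "bordered d x C a K = ?F (a i)"
    using upd[of "a i"] by simp
  have K: "bordered d x C (a(i := 0)) (insert i K)
      = ?R(i := \<lambda>j. of_bool (j = i), d + i := \<lambda>j. of_bool (j = d + i))"
    using assms by (intro ext) (auto simp: bordered_def)
  show ?thesis
    unfolding a upd[of "- a i"] K by (rule row_det_symmetric_perturbation) (use assms in auto)
qed

text \<open>The lower right block is the identity for every \<open>K\<close>, so it commutes with
  the lower left block and the determinant is that of the Schur complement. The rows of the lower
  left block with index in \<open>K\<close> vanish, which restricts the inner sum to the complement
  of \<open>K\<close>.\<close>

lemma row_det_bordered_schur:
  fixes C :: "nat \<Rightarrow> nat \<Rightarrow> 'a::idom"
  shows "row_det (d + d) (bordered d x C a K) = row_det d (\<lambda>i j.
    (if i \<in> K then 1 else x) * of_bool (i = j)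
      - (\<Sum>k\<in>{0..<d} - K. (if i \<in> K then 0 else a i * of_bool (i = k) + C i k)
                          * (a k * of_bool (j = k) + C j k)))"
    (is "_ = row_det d ?S")
proof -
  let ?X = "mat d d (\<lambda>(i, j). (if i \<in> K then 1 else x) * of_bool (i = j))"
  let ?M = "mat d d (\<lambda>(i, k). if i \<in> K then 0 else a i * of_bool (i = k) + C i k)"
  let ?N = "mat d d (\<lambda>(k, j). if k \<in> K then 0 else a k * of_bool (j = k) + C j k)"
  have "mat (d + d) (d + d) (\<lambda>(i, j). bordered d x C a K i j) = four_block_mat ?X ?M ?N (1\<^sub>m d)"
    by (intro eq_matI) (auto simp: bordered_def)
  then have "row_det (d + d) (bordered d x C a K) = det (?X * 1\<^sub>m d - ?M * ?N)"
    unfolding row_det_def by (simp add: det_four_block_mat[of _ d])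
  also have "?X * 1\<^sub>m d - ?M * ?N = mat d d (\<lambda>(i, j). ?S i j)"
  proof (intro eq_matI)
    fix i j assume "i < dim_row (mat d d (\<lambda>(i, j). ?S i j))" "j < dim_col (mat d d (\<lambda>(i, j). ?S i j))"
    then have ij: "i < d" "j < d" by auto
    have "(?M * ?N) $$ (i, j) = (\<Sum>k = 0..<d. ?M $$ (i, k) * ?N $$ (k, j))"
      using ij by (simp add: scalar_prod_def)
    also have "\<dots> = (\<Sum>k\<in>{0..<d} - K. ?M $$ (i, k) * ?N $$ (k, j))"
      using ij by (intro sum.mono_neutral_right) auto
    also have "\<dots> = (\<Sum>k\<in>{0..<d} - K. (if i \<in> K then 0 else a i * of_bool (i = k) + C i k)
                          * (a k * of_bool (j = k) + C j k))"
      using ij by (intro sum.cong) auto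
    finally show "(?X * 1\<^sub>m d - ?M * ?N) $$ (i, j) = mat d d (\<lambda>(i, j). ?S i j) $$ (i, j)"
      using ij by simp
  qed auto
  finally show ?thesis by (simp only: row_det_def)
qed

text \<open>Induction on \<open>T\<close>, applying \<open>step\<close> to one index at a time.
  Every index is set to zero in \<open>a\<close>; it either leaves \<open>K\<close> as it is or
  joins \<open>K\<close> at the price of the factor - (a i)^2, and \<open>L\<close> collects the
  indices of the second kind. Both \<open>a\<close> and \<open>K\<close> change on the way, so both
  are generalised.\<close>

lemma sum_sign_flips:
  fixes Q :: "('b \<Rightarrow> 'a::comm_ring_1) \<Rightarrow> 'b set \<Rightarrow> 'a"
  assumes step: "\<And>a K i. i \<in> V \<Longrightarrow> i \<notin> K \<Longrightarrow>
      Q a K + Q (a(i := - a i)) K = 2 * Q (a(i := 0)) K - 2 * (a i)\<^sup>2 * Q (a(i := 0)) (insert i K)"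
    and "finite T" "T \<subseteq> V" "T \<inter> K = {}"
  shows "(\<Sum>s\<in>Pow T. Q (\<lambda>i. if i \<in> s then - a i else a i) K)
    = 2 ^ card T * (\<Sum>L\<in>Pow T. (-1) ^ card L * (\<Prod>i\<in>L. (a i)\<^sup>2) *
                      Q (\<lambda>i. if i \<in> T then 0 else a i) (K \<union> L))"
  using assms(2-)
proof (induction T arbitrary: a K)
  case empty
  then show ?case by simp
next
  case (insert i T)
  let ?f = "\<lambda>s a i. if i \<in> s then - a i else (a i :: 'a)"
  let ?z = "\<lambda>T i. if i \<in> T then 0 else a i"
  \<comment> \<open>The subsets of \<open>insert i T\<close> come in pairs \<open>s\<close>,
    \<open>insert i s\<close>, and \<open>step\<close> applies to such a pair.\<close>
  have split: "sum g (Pow (insert i T)) = (\<Sum>s\<in>Pow T. g s + g (insert i s))" for g :: "'b set \<Rightarrow> 'a"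
  proof -
    have "sum g (Pow (insert i T)) = sum g (Pow T) + sum g (insert i ` Pow T)"
      unfolding Pow_insert using insert.hyps by (intro sum.union_disjoint) auto
    also have "sum g (insert i ` Pow T) = (\<Sum>s\<in>Pow T. g (insert i s))"
      using insert.hyps by (subst sum.reindex) (auto intro!: inj_onI simp: o_def)
    finally show ?thesis by (simp add: sum.distrib)
  qed
  let ?t = "\<lambda>K L. (-1) ^ card L * (\<Prod>i\<in>L. (a i)\<^sup>2) * Q (?z (insert i T)) (K \<union> L)"
  have IH: "(\<Sum>s\<in>Pow T. Q (?f s (a(i := 0))) K') = 2 ^ card T * sum (?t K') (Pow T)"
    if "K' = K \<or> K' = insert i K" for K'
  proof -
    have "(\<lambda>j. if j \<in> T then 0 else (a(i := 0)) j) = ?z (insert i T)"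
      by auto
    moreover have "(\<Prod>j\<in>L. ((a(i := 0)) j)\<^sup>2) = (\<Prod>j\<in>L. (a j)\<^sup>2)" if "L \<in> Pow T" for L
      using that insert.hyps by (intro prod.cong) auto
    moreover have "T \<subseteq> V" "T \<inter> K' = {}"
      using insert.prems insert.hyps that by auto
    ultimately show ?thesis
      using insert.IH[of K' "a(i := 0)"]
      by (auto simp del: fun_upd_apply intro!: sum.cong arg_cong[of _ _ "(*) (2 ^ card T)"])
  qed
  have "Q (?f s a) K + Q (?f (insert i s) a) K
      = 2 * Q (?f s (a(i := 0))) K - 2 * (a i)\<^sup>2 * Q (?f s (a(i := 0))) (insert i K)"
    if "s \<in> Pow T" for s
  proof -
    \<comment> \<open>As \<open>i\<close> is not in \<open>s\<close>, flipping the signs in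
      \<open>s\<close> does not interfere with changing the value at \<open>i\<close>.\<close>
    have "?f (insert i s) a = (?f s a)(i := - ?f s a i)" "(?f s a)(i := 0) = ?f s (a(i := 0))"
      "?f s a i = a i"
      using that insert.hyps by (auto intro!: ext)
    then show ?thesis
      using step[of i K "?f s a"] insert.prems by auto
  qed
  then have "(\<Sum>s\<in>Pow (insert i T). Q (?f s a) K)
      = 2 * (\<Sum>s\<in>Pow T. Q (?f s (a(i := 0))) K)
        - 2 * (a i)\<^sup>2 * (\<Sum>s\<in>Pow T. Q (?f s (a(i := 0))) (insert i K))"
    by (simp add: split sum_subtractf sum_distrib_left del: fun_upd_apply)
  also have "\<dots> = 2 ^ card (insert i T) * (\<Sum>L\<in>Pow T. ?t K L - (a i)\<^sup>2 * ?t (insert i K) L)"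
  proof -
    have "(\<Sum>L\<in>Pow T. ?t K L - (a i)\<^sup>2 * ?t (insert i K) L)
        = sum (?t K) (Pow T) - (a i)\<^sup>2 * sum (?t (insert i K)) (Pow T)"
      by (simp only: sum_subtractf sum_distrib_left)
    moreover have "2 * (2 ^ card T * u) - 2 * c * (2 ^ card T * v) = 2 ^ card (insert i T) * (u - c * v)"
      for u v c :: 'a
      using insert.hyps by (simp add: algebra_simps)
    ultimately show ?thesis
      using IH[of K] IH[of "insert i K"] by (simp only: simp_thms)
  qed
  also have "(\<Sum>L\<in>Pow T. ?t K L - (a i)\<^sup>2 * ?t (insert i K) L) = (\<Sum>L\<in>Pow (insert i T). ?t K L)"
    unfolding split
  proof (intro sum.cong refl)
    fix L assume "L \<in> Pow T"
    then have "finite L" "i \<notin> L"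
      using insert.hyps finite_subset by auto
    then show "?t K L - (a i)\<^sup>2 * ?t (insert i K) L = ?t K L + ?t K (insert i L)"
      by simp
  qed
  finally show ?case .
qed

section \<open>Permutations mapping one set into another\<close>

text \<open>
  Precomposing with the transposition of w and u, for each u outside W, shows that all such u are
  equally likely to be mapped into V.
\<close>
lemma card_permutations_image_subset_insert:
  assumes "finite S" "insert w W \<subseteq> S" "V \<subseteq> S" "w \<notin> W"
  shows "card {p. p permutes S \<and> p ` insert w W \<subseteq> V} * (card S - card W)
    = card {p. p permutes S \<and> p ` W \<subseteq> V} * (card V - card W)"
proof -
  let ?A = "{p. p permutes S \<and> p ` W \<subseteq> V}"
  let ?B = "\<lambda>u. {p \<in> ?A. p u \<in> V}"
  have fin: "finite ?A" "finite W"
    using assms finite_permutations[of S] finite_subset[of W S] by simp_all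
  have "bij_betw (\<lambda>p. p \<circ> Transposition.transpose w u) (?B u) (?B w)" if "u \<in> S - W" for u
  proof (rule bij_betw_byWitness[where f' = "\<lambda>p. p \<circ> Transposition.transpose w u"])
    \<comment> \<open>Neither \<open>w\<close> nor \<open>u\<close> lies in \<open>W\<close>, so the
      precomposition preserves the condition on the image of \<open>W\<close>.\<close>
    have fix_W: "Transposition.transpose w u y = y" if "y \<in> W" for y
      using that \<open>u \<in> S - W\<close> assms(4) by (auto simp: Transposition.transpose_def)
    have perm: "p \<circ> Transposition.transpose w u permutes S" if "p permutes S" for p
      using that \<open>u \<in> S - W\<close> assms(2) by (intro permutes_compose permutes_swap_id) auto
    show "(\<lambda>p. p \<circ> Transposition.transpose w u) ` ?B u \<subseteq> ?B w"
      "(\<lambda>p. p \<circ> Transposition.transpose w u) ` ?B w \<subseteq> ?B u"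
      using perm fix_W by (auto simp: image_subset_iff)
  qed (simp_all add: o_assoc[symmetric])
  then have "card (?B u) = card (?B w)" if "u \<in> S - W" for u
    using that bij_betw_same_card by blast
  moreover have "?B w = {p. p permutes S \<and> p ` insert w W \<subseteq> V}"
    by auto
  ultimately have "(\<Sum>u\<in>S - W. card (?B u)) = card {p. p permutes S \<and> p ` insert w W \<subseteq> V} * (card S - card W)"
    using fin assms by (simp add: card_Diff_subset)
  \<comment> \<open>The same sum counts pairs of \<open>u\<close> and \<open>p\<close> with
    \<open>p u\<close> in \<open>V\<close>; now it is evaluated with \<open>p\<close> fixed
    first.\<close>
  moreover have "(\<Sum>u\<in>S - W. card (?B u)) = (\<Sum>p\<in>?A. card {u \<in> S - W. p u \<in> V})"
    using sum.swap_restrict[of "S - W" ?A "\<lambda>_ _. 1::nat" "\<lambda>u p. p u \<in> V"] fin assms(1) by simp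
  moreover have "card {u \<in> S - W. p u \<in> V} = card V - card W" if "p \<in> ?A" for p
  proof -
    have p: "p permutes S" "p ` W \<subseteq> V" using that by auto
    have inj: "inj p" using p(1) by (rule permutes_inj)
    have "p ` {u \<in> S - W. p u \<in> V} = V - p ` W"
    proof (intro equalityI subsetI)
      fix v assume v: "v \<in> V - p ` W"
      then have "v \<in> p ` S"
        using permutes_image[OF p(1)] assms(3) by auto
      then show "v \<in> p ` {u \<in> S - W. p u \<in> V}"
        using v by auto
    qed (auto simp: inj_eq[OF inj])
    then have "card {u \<in> S - W. p u \<in> V} = card (V - p ` W)"
      using card_image[OF inj_on_subset[OF inj subset_UNIV], of "{u \<in> S - W. p u \<in> V}"] by simp
    also have "\<dots> = card V - card (p ` W)"
      using p(2) fin(2) by (intro card_Diff_subset) auto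
    finally show ?thesis
      using card_image[OF inj_on_subset[OF inj subset_UNIV], of W] by simp
  qed
  ultimately show ?thesis by simp
qed

text \<open>Adding a point to \<open>W\<close> multiplies the count by the ratio of
  \<open>card V - card W\<close> to \<open>card S - card W\<close>; the factorials solve this
  recursion. The case distinction is needed because subtraction on naturals truncates.\<close>

lemma card_permutations_image_subset:
  assumes "finite S" "W \<subseteq> S" "V \<subseteq> S"
  shows "real (card {p. p permutes S \<and> p ` W \<subseteq> V}) =
    (if card W \<le> card V then fact (card V) * fact (card S - card W) / fact (card V - card W) else 0)"
proof -
  have "finite W" using assms finite_subset by blast
  then show ?thesis
    using assms(2)
  proof (induction W)
    case empty
    then show ?case using assms by (simp add: card_permutations)
  next
    case (insert w W)
    let ?c = "\<lambda>W. real (card {p. p permutes S \<and> p ` W \<subseteq> V})"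
    have less: "card W < card S"
      using insert assms(1) by (metis card_insert_disjoint card_mono less_eq_Suc_le)
    have rec: "?c (insert w W) * real (card S - card W) = ?c W * real (card V - card W)"
      using arg_cong[OF card_permutations_image_subset_insert
          [OF assms(1) insert.prems assms(3) insert.hyps(2)], of real]
      by (simp only: of_nat_mult)
    have nz: "real (card S - card W) \<noteq> 0"
      using less by simp
    show ?case
    proof (cases "card W < card V")
      case True
      have facts: "fact (card S - card W) = real (card S - card W) * fact (card S - Suc (card W))"
        "fact (card V - card W) = real (card V - card W) * fact (card V - Suc (card W))"
        using less True fact_reduce[of "card S - card W", where 'a = real]
          fact_reduce[of "card V - card W", where 'a = real] by simp_all
      have "?c W = fact (card V) * fact (card S - card W) / fact (card V - card W)"
        using insert True by simp
      then have "?c (insert w W) * real (card S - card W)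
          = real (card S - card W) * (fact (card V) * fact (card S - Suc (card W)) / fact (card V - Suc (card W)))"
        unfolding rec facts using True by simp
      then have "?c (insert w W) = fact (card V) * fact (card S - Suc (card W)) / fact (card V - Suc (card W))"
        using nz by (simp only: mult.commute[of "?c _"] mult_cancel_left simp_thms)
      then show ?thesis
        using True insert.hyps by simp
    next
      case False
      \<comment> \<open>Here the truncated difference \<open>card V - card W\<close> is 0, so the
        right side of \<open>rec\<close> vanishes.\<close>
      then have "?c (insert w W) = 0"
        using rec nz by (simp del: of_nat_diff)
      then show ?thesis
        using False insert.hyps by simp
    qed
  qed
qed

section \<open>Signed permutation matrices\<close>

definition signed_perm_mat :: "nat \<Rightarrow> (nat \<Rightarrow> nat) \<Rightarrow> nat set \<Rightarrow> real mat" where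
  "signed_perm_mat d p T = mat d d (\<lambda>(i, j). if i = p j then if j \<in> T then -1 else 1 else 0)"

text \<open>This turns sums over matrices into sums over permutations and sign patterns. From a
  matrix, \<open>p j\<close> is recovered as the row of the nonzero entry in column
  \<open>j\<close>, and \<open>T\<close> as the set of columns whose entry is -1.\<close>

lemma bij_betw_signed_perm_mat:
  "bij_betw (\<lambda>(p, T). signed_perm_mat d p T)
     ({p. p permutes {0..<d}} \<times> Pow {0..<d}) (signed_perm_mats d)"
  unfolding bij_betw_def
proof
  let ?F = "\<lambda>(p, T). signed_perm_mat d p T"
  let ?A = "{p. p permutes {0..<d}} \<times> Pow {0..<d}"
  show "inj_on ?F ?A"
  proof (rule inj_onI, clarify)
    fix p T q U
    assume p: "p permutes {0..<d}" and q: "q permutes {0..<d}" and TU: "T \<subseteq> {0..<d}" "U \<subseteq> {0..<d}"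
      and eq: "signed_perm_mat d p T = signed_perm_mat d q U"
    have ent: "p j = q j \<and> (j \<in> T \<longleftrightarrow> j \<in> U)" if j: "j < d" for j
    proof -
      have "p j < d" using p j permutes_in_image[OF p, of j] by simp
      then have "signed_perm_mat d p T $$ (p j, j) = signed_perm_mat d q U $$ (p j, j)"
        using eq by simp
      then show ?thesis
        using j \<open>p j < d\<close> by (auto simp: signed_perm_mat_def split: if_splits)
    qed
    have "p j = q j" for j
      using ent[of j] p q by (cases "j < d") (auto simp: permutes_def)
    moreover have "T = U" using ent TU by auto
    ultimately show "p = q \<and> T = U" by auto
  qed
  show "?F ` ?A = signed_perm_mats d"
  proof (intro equalityI subsetI)
    fix P assume "P \<in> ?F ` ?A"
    then obtain p T where p: "p permutes {0..<d}" and P: "P = signed_perm_mat d p T" by auto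
    have lt: "p j < d \<longleftrightarrow> j < d" for j
      using permutes_in_image[OF p, of j] by simp
    have "\<exists>!j. j < d \<and> P $$ (i, j) \<noteq> 0" if "i < d" for i
    proof (rule ex1I[of _ "Hilbert_Choice.inv p i"])
      have "Hilbert_Choice.inv p i < d"
        using permutes_in_image[OF permutes_inv[OF p], of i] that by simp
      then show "Hilbert_Choice.inv p i < d \<and> P $$ (i, Hilbert_Choice.inv p i) \<noteq> 0"
        using that permutes_inverses(1)[OF p, of i] by (simp add: P signed_perm_mat_def)
      show "j = Hilbert_Choice.inv p i" if "j < d \<and> P $$ (i, j) \<noteq> 0" for j
        using that \<open>i < d\<close> permutes_inverses(2)[OF p, of j]
        by (auto simp: P signed_perm_mat_def split: if_splits)
    qed
    moreover have "\<exists>!i. i < d \<and> P $$ (i, j) \<noteq> 0" if "j < d" for j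
    proof (rule ex1I[of _ "p j"])
      show "p j < d \<and> P $$ (p j, j) \<noteq> 0"
        using that lt[of j] by (simp add: P signed_perm_mat_def)
      show "i = p j" if "i < d \<and> P $$ (i, j) \<noteq> 0" for i
        using that \<open>j < d\<close> by (auto simp: P signed_perm_mat_def split: if_splits)
    qed
    moreover have "P \<in> carrier_mat d d" "\<forall>i<d. \<forall>j<d. P $$ (i, j) \<in> {0, 1, -1}"
      by (auto simp: P signed_perm_mat_def)
    ultimately show "P \<in> signed_perm_mats d"
      by (simp add: signed_perm_mats_def)
  next
    fix P assume "P \<in> signed_perm_mats d"
    then have P: "P \<in> carrier_mat d d"
      and ent: "\<And>i j. i < d \<Longrightarrow> j < d \<Longrightarrow> P $$ (i, j) \<in> {0, 1, -1}"
      and row: "\<And>i. i < d \<Longrightarrow> \<exists>!j. j < d \<and> P $$ (i, j) \<noteq> 0"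
      and col: "\<And>j. j < d \<Longrightarrow> \<exists>!i. i < d \<and> P $$ (i, j) \<noteq> 0"
      by (auto simp: signed_perm_mats_def)
    \<comment> \<open>The value \<open>j\<close> outside the index range is what
      \<open>permutes\<close> demands.\<close>
    define p where "p j = (if j < d then THE i. i < d \<and> P $$ (i, j) \<noteq> 0 else j)" for j
    define T where "T = {j. j < d \<and> P $$ (p j, j) = -1}"
    have p: "p j < d" "P $$ (p j, j) \<noteq> 0" if "j < d" for j
      using theI'[OF col[OF that]] that by (auto simp: p_def)
    have p_unique: "i = p j" if "i < d" "j < d" "P $$ (i, j) \<noteq> 0" for i j
      using col[OF that(2)] p[OF that(2)] that by blast
    \<comment> \<open>Uniqueness within columns makes \<open>p\<close> well defined; uniqueness
      within rows makes it injective.\<close>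
    have inj: "inj_on p {0..<d}"
    proof (rule inj_onI)
      fix j k assume jk: "j \<in> {0..<d}" "k \<in> {0..<d}" "p j = p k"
      have "j < d \<and> P $$ (p j, j) \<noteq> 0" "k < d \<and> P $$ (p j, k) \<noteq> 0"
        using p[of j] p[of k] jk by auto
      then show "j = k"
        using row[of "p j"] p(1)[of j] jk by blast
    qed
    moreover have "p ` {0..<d} \<subseteq> {0..<d}"
      using p by auto
    ultimately have "bij_betw p {0..<d} {0..<d}"
      by (simp add: bij_betw_def endo_inj_surj)
    then have "p permutes {0..<d}"
      by (rule bij_imp_permutes) (auto simp: p_def)
    moreover have "P = signed_perm_mat d p T"
    proof (rule eq_matI)
      fix i j assume "i < dim_row (signed_perm_mat d p T)" "j < dim_col (signed_perm_mat d p T)"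
      then have ij: "i < d" "j < d" by (auto simp: signed_perm_mat_def)
      show "P $$ (i, j) = signed_perm_mat d p T $$ (i, j)"
      proof (cases "i = p j")
        case True
        have "P $$ (i, j) = 1 \<or> P $$ (i, j) = -1"
          using ent[OF ij] p(2)[OF ij(2)] True by simp
        moreover have "j \<in> T \<longleftrightarrow> P $$ (i, j) = -1"
          using True ij by (simp add: T_def)
        ultimately show ?thesis
          using True ij by (auto simp: signed_perm_mat_def)
      next
        case False
        then have "P $$ (i, j) = 0"
          using p_unique[OF ij] by blast
        then show ?thesis
          using False ij by (simp add: signed_perm_mat_def)
      qed
    qed (use P in \<open>auto simp: signed_perm_mat_def\<close>)
    moreover have "T \<in> Pow {0..<d}" by (auto simp: T_def)
    ultimately show "P \<in> ?F ` ?A" by auto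
  qed
qed

lemma sum_signed_perm_mats:
  "sum f (signed_perm_mats d)
    = (\<Sum>p | p permutes {0..<d}. \<Sum>T\<in>Pow {0..<d}. f (signed_perm_mat d p T))"
proof -
  have "sum f (signed_perm_mats d)
      = (\<Sum>z\<in>{p. p permutes {0..<d}} \<times> Pow {0..<d}. f ((\<lambda>(p, T). signed_perm_mat d p T) z))"
    by (rule sum.reindex_bij_betw[OF bij_betw_signed_perm_mat, symmetric])
  also have "\<dots> = (\<Sum>p | p permutes {0..<d}. \<Sum>T\<in>Pow {0..<d}. f (signed_perm_mat d p T))"
    unfolding sum.cartesian_product by (intro sum.cong) auto
  finally show ?thesis .
qed

lemma card_signed_perm_mats: "card (signed_perm_mats d) = fact d * 2 ^ d"
  using bij_betw_same_card[OF bij_betw_signed_perm_mat[of d]]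
  by (simp add: card_cartesian_product card_permutations card_Pow)

section \<open>Invariance under sign flips of rows\<close>

definition flip_sign :: "nat set \<Rightarrow> nat \<Rightarrow> real" where
  "flip_sign s i = (if i \<in> s then -1 else 1)"

lemma flip_sign_square [simp]: "flip_sign s i * flip_sign s i = 1" "(flip_sign s i)\<^sup>2 = 1"
  by (simp_all add: flip_sign_def)

lemma flip_sign_neq_0 [simp]: "flip_sign s i \<noteq> 0"
  by (simp add: flip_sign_def)

definition flip_rows :: "nat set \<Rightarrow> real mat \<Rightarrow> real mat" where
  "flip_rows s P = mat (dim_row P) (dim_col P) (\<lambda>(i, j). flip_sign s i * P $$ (i, j))"

lemma flip_rows_signed_perm_mats:
  assumes "P \<in> signed_perm_mats d"
  shows "flip_rows s P \<in> signed_perm_mats d"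
proof -
  have P: "P \<in> carrier_mat d d" using assms by (simp add: signed_perm_mats_def)
  have ent: "flip_rows s P $$ (i, j) = flip_sign s i * P $$ (i, j)" if "i < d" "j < d" for i j
    using that P by (simp add: flip_rows_def)
  have nz: "i < d \<and> flip_rows s P $$ (i, j) \<noteq> 0 \<longleftrightarrow> i < d \<and> P $$ (i, j) \<noteq> 0" if "j < d" for i j
    using that by (auto simp: ent)
  have nz': "j < d \<and> flip_rows s P $$ (i, j) \<noteq> 0 \<longleftrightarrow> j < d \<and> P $$ (i, j) \<noteq> 0" if "i < d" for i j
    using that by (auto simp: ent)
  have "\<forall>i<d. \<forall>j<d. flip_rows s P $$ (i, j) \<in> {0, 1, -1}"
    using assms by (auto simp: ent flip_sign_def signed_perm_mats_def)
  moreover have "flip_rows s P \<in> carrier_mat d d"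
    using P by (simp add: flip_rows_def)
  ultimately show ?thesis
    using assms by (simp add: signed_perm_mats_def nz nz')
qed

text \<open>The involution \<open>flip_rows s\<close> permutes the signed permutation matrices, so
  the uniform distribution is invariant under it.\<close>

lemma sum_flip_rows:
  "(\<Sum>P\<in>signed_perm_mats d. f (flip_rows s P)) = sum f (signed_perm_mats d)"
proof (rule sum.reindex_bij_witness[of _ "flip_rows s" "flip_rows s"])
  show "flip_rows s (flip_rows s P) = P" for P
    by (intro eq_matI) (auto simp: flip_rows_def simp flip: mult.assoc)
  then show "flip_rows s (flip_rows s P) = P" for P .
qed (auto intro: flip_rows_signed_perm_mats)

section \<open>Bordered determinants for signed permutation matrices\<close>

lemma row_det_bordered_cong:
  assumes "\<And>i j. i < d \<Longrightarrow> j < d \<Longrightarrow> C i j = C' i j"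
  shows "row_det (d + d) (bordered d x C a K) = row_det (d + d) (bordered d x C' a K)"
  by (intro row_det_cong) (auto simp: bordered_def assms)

text \<open>Let D be the diagonal sign matrix of \<open>s\<close> and A the diagonal matrix of
  \<open>a\<close>. Then D A + C = D (A + D C), so the two Schur complements are conjugate by D,
  whose determinant has square 1.\<close>

lemma row_det_bordered_flip:
  "row_det (d + d) (bordered d x C (\<lambda>i. if i \<in> s then - a i else a i) {})
    = row_det (d + d) (bordered d x (\<lambda>i j. flip_sign s i * C i j) a {})"
proof -
  let ?f = "\<lambda>i. if i \<in> s then - a i else a i"
  let ?S = "\<lambda>C a i j. x * of_bool (i = j)
      - (\<Sum>k = 0..<d. (a i * of_bool (i = k) + C i k) * (a k * of_bool (j = k) + C j k))"
  have schur: "row_det (d + d) (bordered d x C a {}) = row_det d (?S C a)" for C a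
    by (simp add: row_det_bordered_schur)
  have "?S C ?f i j = flip_sign s i * flip_sign s j * ?S (\<lambda>i j. flip_sign s i * C i j) a i j" for i j
  proof -
    have "(?f i * of_bool (i = k) + C i k) * (?f k * of_bool (j = k) + C j k)
        = flip_sign s i * flip_sign s j
          * ((a i * of_bool (i = k) + flip_sign s i * C i k) * (a k * of_bool (j = k) + flip_sign s j * C j k))" for k
      by (auto simp: flip_sign_def algebra_simps)
    moreover have "x * of_bool (i = j) = flip_sign s i * flip_sign s j * (x * of_bool (i = j))"
      by simp
    ultimately show ?thesis
      by (simp only: sum_distrib_left right_diff_distrib)
  qed
  moreover have "(\<Prod>i = 0..<d. flip_sign s i)\<^sup>2 = 1"
    by (simp add: prod_power_distrib)
  ultimately show ?thesis
    unfolding schur by (simp only: row_det_scale_rows_cols mult_1_left)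
qed

lemma det_gram_bordered:
  fixes A C :: "real mat"
  assumes "A \<in> carrier_mat d d" "diagonal_mat A" "C \<in> carrier_mat d d"
  shows "det (x \<cdot>\<^sub>m 1\<^sub>m d - (A + C) * transpose_mat (A + C))
    = row_det (d + d) (bordered d x (\<lambda>i j. C $$ (i, j)) (\<lambda>i. A $$ (i, i)) {})"
proof -
  have diag: "A $$ (i, j) = A $$ (i, i) * of_bool (i = j)" if "i < d" "j < d" for i j
    using assms that by (auto simp: diagonal_mat_def)
  have "row_det (d + d) (bordered d x (\<lambda>i j. C $$ (i, j)) (\<lambda>i. A $$ (i, i)) {})
      = row_det d (\<lambda>i j. x * of_bool (i = j)
      - (\<Sum>k = 0..<d. (A $$ (i, i) * of_bool (i = k) + C $$ (i, k)) * (A $$ (k, k) * of_bool (j = k) + C $$ (j, k))))"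
    by (simp add: row_det_bordered_schur)
  also have "\<dots> = det (x \<cdot>\<^sub>m 1\<^sub>m d - (A + C) * transpose_mat (A + C))"
    unfolding row_det_def
  proof (intro arg_cong[of _ _ det] eq_matI)
    fix i j
    assume "i < dim_row (x \<cdot>\<^sub>m 1\<^sub>m d - (A + C) * transpose_mat (A + C))"
      "j < dim_col (x \<cdot>\<^sub>m 1\<^sub>m d - (A + C) * transpose_mat (A + C))"
    then have ij: "i < d" "j < d" using assms by auto
    have "((A + C) * transpose_mat (A + C)) $$ (i, j) = (\<Sum>k = 0..<d. (A + C) $$ (i, k) * (A + C) $$ (j, k))"
      using ij assms by (simp add: scalar_prod_def)
    also have "\<dots> = (\<Sum>k = 0..<d. (A $$ (i, i) * of_bool (i = k) + C $$ (i, k)) * (A $$ (k, k) * of_bool (j = k) + C $$ (j, k)))"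
    proof (intro sum.cong refl arg_cong2[of _ _ _ _ "(*)"])
      fix k assume "k \<in> {0..<d}"
      then have k: "k < d" by simp
      show "(A + C) $$ (i, k) = A $$ (i, i) * of_bool (i = k) + C $$ (i, k)"
        using diag[OF ij(1) k] ij k assms by simp
      show "(A + C) $$ (j, k) = A $$ (k, k) * of_bool (j = k) + C $$ (j, k)"
        using diag[OF ij(2) k] ij k assms by (cases "j = k") simp_all
    qed
    finally show "mat d d (\<lambda>(i, j). x * of_bool (i = j) - (\<Sum>k = 0..<d. (A $$ (i, i) * of_bool (i = k)
        + C $$ (i, k)) * (A $$ (k, k) * of_bool (j = k) + C $$ (j, k)))) $$ (i, j)
        = (x \<cdot>\<^sub>m 1\<^sub>m d - (A + C) * transpose_mat (A + C)) $$ (i, j)"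
      using ij assms by simp
  qed (use assms in auto)
  finally show ?thesis by simp
qed

text \<open>With \<open>a\<close> zero, an off-diagonal entry of the Schur complement could only
  come from a column shared by two rows of \<open>C\<close>, and injectivity of \<open>t\<close>
  excludes this. So the complement is diagonal: rows in \<open>L\<close> contribute 1, and a square
  is lost when its column \<open>t i\<close> is among the omitted indices.\<close>

lemma row_det_bordered_monomial:
  fixes C :: "nat \<Rightarrow> nat \<Rightarrow> real"
  assumes zero: "\<And>i. i < d \<Longrightarrow> a i = 0"
    and C: "\<And>i j. i < d \<Longrightarrow> j < d \<Longrightarrow> j \<noteq> t i \<Longrightarrow> C i j = 0"
    and t: "\<And>i. i < d \<Longrightarrow> t i < d" "inj_on t {0..<d}"
  shows "row_det (d + d) (bordered d x C a L)
    = (\<Prod>i\<in>{0..<d} - L. x - of_bool (t i \<notin> L) * (C i (t i))\<^sup>2)"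
proof -
  have ent: "(\<Sum>k\<in>{0..<d} - L. (if i \<in> L then 0 else a i * of_bool (i = k) + C i k)
                          * (a k * of_bool (j = k) + C j k))
      = of_bool (i = j \<and> i \<notin> L \<and> t i \<notin> L) * (C i (t i))\<^sup>2" if ij: "i < d" "j < d" for i j
  proof -
    have "(\<Sum>k\<in>{0..<d} - L. (if i \<in> L then 0 else a i * of_bool (i = k) + C i k)
                          * (a k * of_bool (j = k) + C j k))
        = (\<Sum>k\<in>{0..<d} - L. if k = t i then of_bool (i = j \<and> i \<notin> L) * (C i (t i))\<^sup>2 else 0)"
    proof (intro sum.cong refl)
      fix k assume k: "k \<in> {0..<d} - L"
      have "C j (t i) = 0" if "i \<noteq> j"
      proof (rule C)
        show "t i \<noteq> t j"
          using inj_on_eq_iff[OF t(2), of i j] ij that by simp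
      qed (use ij t(1) in simp_all)
      then show "(if i \<in> L then 0 else a i * of_bool (i = k) + C i k) * (a k * of_bool (j = k) + C j k)
          = (if k = t i then of_bool (i = j \<and> i \<notin> L) * (C i (t i))\<^sup>2 else 0)"
        using k ij C[of i k] zero[of i] zero[of k] by (auto simp: power2_eq_square)
    qed
    also have "\<dots> = of_bool (i = j \<and> i \<notin> L \<and> t i \<notin> L) * (C i (t i))\<^sup>2"
      using t(1)[OF ij(1)] by (simp add: sum.delta)
    finally show ?thesis .
  qed
  let ?g = "\<lambda>i. (if i \<in> L then 1 else x) - of_bool (i \<notin> L \<and> t i \<notin> L) * (C i (t i))\<^sup>2"
  have "row_det (d + d) (bordered d x C a L)
      = row_det d (\<lambda>i j. if i = j then ?g i else 0)"
    unfolding row_det_bordered_schur by (intro row_det_cong) (simp add: ent)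
  also have "\<dots> = (\<Prod>i = 0..<d. ?g i)"
    by (subst row_det_diagonal) (auto simp: atLeast0LessThan)
  also have "\<dots> = (\<Prod>i\<in>{0..<d} - L. ?g i)"
    by (intro prod.mono_neutral_right) auto
  also have "\<dots> = (\<Prod>i\<in>{0..<d} - L. x - of_bool (t i \<notin> L) * (C i (t i))\<^sup>2)"
    by (intro prod.cong) auto
  finally show ?thesis .
qed

text \<open>The two signed permutations carry the diagonal entry of \<open>B\<close> at
  \<open>m\<close> to the position (p m, q m); \<open>m\<close> is expressed through the target row
  \<open>i\<close>.\<close>

lemma signed_perm_conjugate_entry:
  assumes p: "p permutes {0..<d}" and q: "q permutes {0..<d}"
    and B: "B \<in> carrier_mat d d" "diagonal_mat B" and ij: "i < d" "j < d"
  defines "m \<equiv> Hilbert_Choice.inv p i"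
  shows "(signed_perm_mat d p T * B * transpose_mat (signed_perm_mat d q U)) $$ (i, j)
    = of_bool (j = q m) * (flip_sign T m * flip_sign U m * B $$ (m, m))"
proof -
  let ?P = "signed_perm_mat d p T" and ?S = "signed_perm_mat d q U"
  have m: "m < d" "p m = i"
    unfolding m_def using permutes_in_image[OF permutes_inv[OF p], of i] permutes_inverses(1)[OF p] ij by auto
  have p_eq: "i = p k \<longleftrightarrow> k = m" for k
    unfolding m_def using permutes_inverses[OF p] by metis
  have "(?P * B) $$ (i, k) = (\<Sum>l = 0..<d. ?P $$ (i, l) * B $$ (l, k))" if "k < d" for k
    using that ij B by (simp add: scalar_prod_def signed_perm_mat_def)
  moreover have "(\<Sum>l = 0..<d. ?P $$ (i, l) * B $$ (l, k))
      = (\<Sum>l = 0..<d. if l = m then flip_sign T m * B $$ (m, k) else 0)" if "k < d" for k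
    using that ij by (intro sum.cong) (auto simp: signed_perm_mat_def p_eq flip_sign_def)
  ultimately have PB: "(?P * B) $$ (i, k) = flip_sign T m * B $$ (m, k)" if "k < d" for k
    using that m by (simp add: sum.delta)
  have "(?P * B * transpose_mat ?S) $$ (i, j) = (\<Sum>k = 0..<d. (?P * B) $$ (i, k) * ?S $$ (j, k))"
    using ij B by (simp add: scalar_prod_def signed_perm_mat_def)
  also have "\<dots> = (\<Sum>k = 0..<d. if k = m then flip_sign T m * B $$ (m, m) * ?S $$ (j, m) else 0)"
    using B m by (intro sum.cong) (auto simp: PB diagonal_mat_def)
  also have "\<dots> = flip_sign T m * B $$ (m, m) * ?S $$ (j, m)"
    using m by (simp add: sum.delta)
  also have "?S $$ (j, m) = of_bool (j = q m) * flip_sign U m"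
    using ij m by (simp add: signed_perm_mat_def flip_sign_def)
  finally show ?thesis by (simp add: mult_ac)
qed

text \<open>The monomial case applies with \<open>t\<close> the composition of \<open>q\<close> with
  the inverse of \<open>p\<close>. Reindexing by \<open>i = p m\<close> gives one factor for each
  \<open>m\<close> with \<open>p m\<close> outside \<open>L\<close>, and the signs disappear in the
  squares. Expanding the product and writing both restrictions on \<open>W\<close> as indicators
  separates \<open>p\<close> from \<open>q\<close>, as independence requires.\<close>

lemma row_det_bordered_signed_perm:
  fixes T U :: "nat set"
  assumes p: "p permutes {0..<d}" and q: "q permutes {0..<d}"
    and B: "B \<in> carrier_mat d d" "diagonal_mat B"
    and zero: "\<And>i. i < d \<Longrightarrow> a i = 0" and L: "L \<subseteq> {0..<d}"
  defines "C \<equiv> \<lambda>i j. (signed_perm_mat d p T * B * transpose_mat (signed_perm_mat d q U)) $$ (i, j)"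
  shows "row_det (d + d) (bordered d x C a L)
    = (\<Sum>W\<in>Pow {0..<d}. (-1) ^ card W * x ^ (d - card L - card W) * (\<Prod>m\<in>W. (B $$ (m, m))\<^sup>2)
        * (of_bool (p ` W \<subseteq> {0..<d} - L) * of_bool (q ` W \<subseteq> {0..<d} - L)))"
proof -
  let ?b = "\<lambda>m. (B $$ (m, m))\<^sup>2"
  let ?V = "{m \<in> {0..<d}. p m \<notin> L}"
  have lt: "p i < d \<longleftrightarrow> i < d" "Hilbert_Choice.inv p i < d \<longleftrightarrow> i < d" "q i < d \<longleftrightarrow> i < d" for i
    using permutes_in_image[OF p, of i] permutes_in_image[OF permutes_inv[OF p], of i]
      permutes_in_image[OF q, of i] by auto
  have pV: "p ` ?V = {0..<d} - L"
  proof (intro equalityI subsetI)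
    fix i assume "i \<in> {0..<d} - L"
    then have "Hilbert_Choice.inv p i \<in> ?V" "i = p (Hilbert_Choice.inv p i)"
      using permutes_inverses(1)[OF p] lt by auto
    then show "i \<in> p ` ?V" by blast
  qed (use lt in auto)
  have inj: "inj_on p X" for X
    using permutes_inj[OF p] inj_on_subset by blast
  have card_V: "card ?V = d - card L"
    using card_image[OF inj, of ?V] L finite_subset[OF L] unfolding pV by (simp add: card_Diff_subset)
  have "row_det (d + d) (bordered d x C a L)
      = (\<Prod>i\<in>{0..<d} - L. x - of_bool (q (Hilbert_Choice.inv p i) \<notin> L) * (C i (q (Hilbert_Choice.inv p i)))\<^sup>2)"
  proof (rule row_det_bordered_monomial[OF zero])
    show "inj_on (\<lambda>i. q (Hilbert_Choice.inv p i)) {0..<d}"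
      using permutes_inj[OF permutes_compose[OF permutes_inv[OF p] q]]
      by (auto simp: inj_on_def)
  qed (auto simp: C_def lt signed_perm_conjugate_entry[OF p q B])
  also have "\<dots> = (\<Prod>i\<in>p ` ?V. x - of_bool (q (Hilbert_Choice.inv p i) \<notin> L) * ?b (Hilbert_Choice.inv p i))"
    unfolding pV by (intro prod.cong refl)
      (auto simp: C_def lt signed_perm_conjugate_entry[OF p q B] power_mult_distrib)
  also have "\<dots> = (\<Prod>m\<in>?V. x - of_bool (q m \<notin> L) * ?b m)"
    by (subst prod.reindex[OF inj]) (simp add: permutes_inverses(2)[OF p])
  \<comment> \<open>\<open>W\<close> is the set of factors from which the second summand is
    chosen.\<close>
  also have "\<dots> = (\<Sum>W\<in>Pow ?V. (-1) ^ card W * (\<Prod>m\<in>W. of_bool (q m \<notin> L) * ?b m) * (\<Prod>m\<in>?V - W. x))"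
    by (rule prod_diff_conv_sum) simp
  also have "\<dots> = (\<Sum>W\<in>Pow ?V. (-1) ^ card W * x ^ (d - card L - card W) * (\<Prod>m\<in>W. ?b m)
        * (of_bool (p ` W \<subseteq> {0..<d} - L) * of_bool (q ` W \<subseteq> {0..<d} - L)))"
  proof (intro sum.cong refl)
    fix W assume W: "W \<in> Pow ?V"
    have fin: "finite W" using W finite_subset[of W ?V] by simp
    have "card (?V - W) = d - card L - card W"
      using card_Diff_subset[OF fin, of ?V] W card_V by simp
    moreover have "p ` W \<subseteq> {0..<d} - L"
      using W pV by blast
    moreover have "(\<Prod>m\<in>W. of_bool (q m \<notin> L) :: real) = of_bool (q ` W \<subseteq> {0..<d} - L)"
    proof (cases "q ` W \<subseteq> {0..<d} - L")
      case True
      then show ?thesis by (auto intro!: prod.neutral)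
    next
      case False
      then obtain m where "m \<in> W" "q m \<in> L" using W lt by auto
      then show ?thesis using False fin by (auto intro!: prod_zero)
    qed
    ultimately show "(-1) ^ card W * (\<Prod>m\<in>W. of_bool (q m \<notin> L) * ?b m) * (\<Prod>m\<in>?V - W. x)
        = (-1) ^ card W * x ^ (d - card L - card W) * (\<Prod>m\<in>W. ?b m)
        * (of_bool (p ` W \<subseteq> {0..<d} - L) * of_bool (q ` W \<subseteq> {0..<d} - L))"
      by (simp add: prod.distrib)
  qed
  \<comment> \<open>The indicator for \<open>p\<close> vanishes on every \<open>W\<close> not
    contained in \<open>?V\<close>, so the sum may run over all subsets.\<close>
  also have "\<dots> = (\<Sum>W\<in>Pow {0..<d}. (-1) ^ card W * x ^ (d - card L - card W) * (\<Prod>m\<in>W. ?b m)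
        * (of_bool (p ` W \<subseteq> {0..<d} - L) * of_bool (q ` W \<subseteq> {0..<d} - L)))"
    by (intro sum.mono_neutral_left) auto
  finally show ?thesis .
qed

section \<open>The expected characteristic polynomial\<close>

lemma index_mult_transpose:
  assumes "X \<in> carrier_mat n m" "Y \<in> carrier_mat k m" "i < n" "j < k"
  shows "(X * transpose_mat Y) $$ (i, j) = (\<Sum>l = 0..<m. X $$ (i, l) * Y $$ (j, l))"
  using assms by (simp add: scalar_prod_def)

text \<open>The Gram matrix is diagonal with the squares as entries. Since \<open>pick I\<close>
  enumerates \<open>I\<close> injectively, each principal submatrix is again diagonal, and its
  determinant reindexes to a product over \<open>I\<close>.\<close>

lemma esum_minors_diagonal_gram:
  assumes A: "A \<in> carrier_mat d d" "diagonal_mat A"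
  shows "esum_minors k (A * transpose_mat A)
    = (\<Sum>I | I \<subseteq> {0..<d} \<and> card I = k. \<Prod>i\<in>I. (A $$ (i, i))\<^sup>2)"
proof -
  let ?G = "A * transpose_mat A"
  have G: "?G $$ (i, j) = (if i = j then (A $$ (i, i))\<^sup>2 else 0)" if ij: "i < d" "j < d" for i j
  proof -
    have "?G $$ (i, j) = (\<Sum>k = 0..<d. A $$ (i, k) * A $$ (j, k))"
      using ij A by (simp add: scalar_prod_def)
    also have "\<dots> = (\<Sum>k = 0..<d. if k = i then A $$ (i, i) * A $$ (j, i) else 0)"
      using A ij by (intro sum.cong) (auto simp: diagonal_mat_def)
    also have "\<dots> = A $$ (i, i) * A $$ (j, i)"
      using ij by (simp add: sum.delta)
    also have "\<dots> = (if i = j then (A $$ (i, i))\<^sup>2 else 0)"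
      using A ij by (auto simp: diagonal_mat_def power2_eq_square)
    finally show ?thesis .
  qed
  have "det (submatrix ?G I I) = (\<Prod>i\<in>I. (A $$ (i, i))\<^sup>2)" if I: "I \<subseteq> {0..<d}" for I
  proof -
    have card: "card {i. i < d \<and> i \<in> I} = card I"
      using I by (intro arg_cong[of _ _ card]) auto
    have pick_lt: "pick I i < d" if "i < card I" for i
      using pick_in_set_le[OF that] I by auto
    have inj: "inj_on (pick I) {..<card I}"
    proof (rule linorder_inj_onI')
      fix i j assume "i \<in> {..<card I}" "j \<in> {..<card I}" "i < j"
      then show "pick I i \<noteq> pick I j"
        using pick_mono_le[of j I i] by simp
    qed
    have "pick I ` {..<card I} \<subseteq> I"
      using pick_in_set_le by auto
    then have img: "pick I ` {..<card I} = I"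
      using card_image[OF inj] I finite_subset[OF I] by (intro card_subset_eq) auto
    have "submatrix ?G I I = mat (card I) (card I) (\<lambda>(i, j). ?G $$ (pick I i, pick I j))"
      using A card by (simp add: submatrix_def)
    then have "det (submatrix ?G I I) = row_det (card I) (\<lambda>i j. ?G $$ (pick I i, pick I j))"
      by (simp add: row_det_def)
    also have "\<dots> = row_det (card I) (\<lambda>i j. if i = j then (A $$ (pick I i, pick I i))\<^sup>2 else 0)"
    proof (rule row_det_cong)
      fix i j assume ij: "i < card I" "j < card I"
      then show "?G $$ (pick I i, pick I j) = (if i = j then (A $$ (pick I i, pick I i))\<^sup>2 else 0)"
        using G[OF pick_lt pick_lt] inj_on_eq_iff[OF inj, of i j] by simp
    qed
    also have "\<dots> = (\<Prod>i<card I. (A $$ (pick I i, pick I i))\<^sup>2)"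
      by (subst row_det_diagonal) auto
    also have "\<dots> = (\<Prod>i\<in>pick I ` {..<card I}. (A $$ (i, i))\<^sup>2)"
      by (subst prod.reindex[OF inj]) simp
    finally show ?thesis unfolding img .
  qed
  then show ?thesis
    using A by (auto simp: esum_minors_def intro!: sum.cong)
qed

text \<open>Independence is encoded by \<open>pair_pmf\<close>, so every pair of matrices has the
  product weight.\<close>

lemma expectation_random_signed_perm_pair:
  fixes f :: "real mat \<Rightarrow> real mat \<Rightarrow> real"
  shows "measure_pmf.expectation (pair_pmf (random_signed_perm_mat d) (random_signed_perm_mat d))
      (\<lambda>(P, S). f P S)
    = (\<Sum>P\<in>signed_perm_mats d. \<Sum>S\<in>signed_perm_mats d. f P S) / (fact d * 2 ^ d)\<^sup>2"
proof -
  let ?R = "random_signed_perm_mat d"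
  let ?S = "signed_perm_mats d"
  have set: "set_pmf ?R = ?S"
    by (simp add: random_signed_perm_mat_def set_pmf_of_set finite_signed_perm_mats signed_perm_mats_nonempty)
  have pmf: "pmf ?R P = 1 / (fact d * 2 ^ d)" if "P \<in> ?S" for P
    using that by (simp add: random_signed_perm_mat_def pmf_of_set finite_signed_perm_mats
        signed_perm_mats_nonempty card_signed_perm_mats)
  have "measure_pmf.expectation (pair_pmf ?R ?R) (\<lambda>(P, S). f P S)
      = (\<Sum>z\<in>?S \<times> ?S. (\<lambda>(P, S). f P S) z * pmf (pair_pmf ?R ?R) z)"
    by (rule integral_measure_pmf_real) (auto simp: finite_signed_perm_mats set)
  also have "\<dots> = (\<Sum>z\<in>?S \<times> ?S. (\<lambda>(P, S). f P S) z / (fact d * 2 ^ d)\<^sup>2)"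
    by (intro sum.cong) (auto simp: pmf_pair pmf power2_eq_square)
  finally show ?thesis
    by (simp add: sum_divide_distrib sum.cartesian_product split_def)
qed

lemma sum_Pow_by_card:
  assumes "finite S"
  shows "(\<Sum>L\<in>Pow S. f L) = (\<Sum>i = 0..card S. \<Sum>L | L \<subseteq> S \<and> card L = i. f L)"
proof -
  have "(\<Sum>L\<in>Pow S. f L) = (\<Sum>i = 0..card S. \<Sum>L | L \<in> Pow S \<and> card L = i. f L)"
    using assms by (intro sum.group[symmetric]) (auto intro: card_mono)
  then show ?thesis by simp
qed

text \<open>The hypothesis cuts the square of indices down to the triangle
  \<open>i + j \<le> d\<close>, which is then grouped by the value of \<open>i + j\<close>.\<close>

lemma sum_antidiagonals:
  fixes h :: "nat \<Rightarrow> nat \<Rightarrow> 'a::comm_monoid_add"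
  assumes "\<And>i j. d < i + j \<Longrightarrow> h i j = 0"
  shows "(\<Sum>i = 0..d. \<Sum>j = 0..d. h i j) = (\<Sum>k = 0..d. \<Sum>(i, j) | i + j = k. h i j)"
proof -
  let ?D = "{(i, j). i + j \<le> d}"
  have D: "?D \<subseteq> {0..d} \<times> {0..d}" by auto
  have fin: "finite ?D" using finite_subset[OF D] by simp
  have "(\<Sum>i = 0..d. \<Sum>j = 0..d. h i j) = (\<Sum>z\<in>{0..d} \<times> {0..d}. case z of (i, j) \<Rightarrow> h i j)"
    by (simp add: sum.cartesian_product)
  also have "\<dots> = (\<Sum>z\<in>?D. case z of (i, j) \<Rightarrow> h i j)"
  proof (intro sum.mono_neutral_right ballI)
    fix z assume "z \<in> {0..d} \<times> {0..d} - ?D"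
    then show "(case z of (i, j) \<Rightarrow> h i j) = 0"
      by (auto simp: not_le intro: assms)
  qed (use D in auto)
  also have "\<dots> = (\<Sum>k = 0..d. \<Sum>z | z \<in> ?D \<and> fst z + snd z = k. case z of (i, j) \<Rightarrow> h i j)"
    using fin by (intro sum.group[symmetric]) auto
  also have "\<dots> = (\<Sum>k = 0..d. \<Sum>(i, j) | i + j = k. h i j)"
    by (intro sum.cong refl) auto
  finally show ?thesis .
qed

text \<open>The determinant does not depend on the sign patterns, so each of the two sums over them
  gives 2^d. The sums over \<open>p\<close> and \<open>q\<close> then factor for fixed
  \<open>W\<close> into two equal counts, hence the square.\<close>

lemma sum_signed_perm_bordered:
  assumes B: "B \<in> carrier_mat d d" "diagonal_mat B"
    and zero: "\<And>i. i < d \<Longrightarrow> a i = 0" and L: "L \<subseteq> {0..<d}"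
  shows "(\<Sum>P\<in>signed_perm_mats d. \<Sum>S\<in>signed_perm_mats d.
      row_det (d + d) (bordered d x (\<lambda>i j. (P * B * transpose_mat S) $$ (i, j)) a L))
    = (2 ^ d)\<^sup>2 * (\<Sum>W\<in>Pow {0..<d}. (-1) ^ card W * x ^ (d - card L - card W) * (\<Prod>m\<in>W. (B $$ (m, m))\<^sup>2)
        * (real (card {p. p permutes {0..<d} \<and> p ` W \<subseteq> {0..<d} - L}))\<^sup>2)"
proof -
  let ?Pi = "{p. p permutes {0..<d}}"
  let ?u = "\<lambda>W. (-1) ^ card W * x ^ (d - card L - card W) * (\<Prod>m\<in>W. (B $$ (m, m))\<^sup>2)"
  let ?g = "\<lambda>p W. of_bool (p ` W \<subseteq> {0..<d} - L) :: real"
  have fin: "finite ?Pi" by (simp add: finite_permutations)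
  have "(\<Sum>P\<in>signed_perm_mats d. \<Sum>S\<in>signed_perm_mats d.
      row_det (d + d) (bordered d x (\<lambda>i j. (P * B * transpose_mat S) $$ (i, j)) a L))
    = (\<Sum>p\<in>?Pi. \<Sum>T\<in>Pow {0..<d}. \<Sum>q\<in>?Pi. \<Sum>U\<in>Pow {0..<d}.
        \<Sum>W\<in>Pow {0..<d}. ?u W * (?g p W * ?g q W))"
    unfolding sum_signed_perm_mats
    by (intro sum.cong refl row_det_bordered_signed_perm B L zero) auto
  also have "\<dots> = (2 ^ d)\<^sup>2 * (\<Sum>p\<in>?Pi. \<Sum>q\<in>?Pi. \<Sum>W\<in>Pow {0..<d}. ?u W * (?g p W * ?g q W))"
    by (simp add: card_Pow sum_distrib_left power2_eq_square mult.assoc)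
  also have "(\<Sum>p\<in>?Pi. \<Sum>q\<in>?Pi. \<Sum>W\<in>Pow {0..<d}. ?u W * (?g p W * ?g q W))
      = (\<Sum>p\<in>?Pi. \<Sum>W\<in>Pow {0..<d}. \<Sum>q\<in>?Pi. ?u W * (?g p W * ?g q W))"
    by (intro sum.cong refl sum.swap)
  also have "\<dots> = (\<Sum>W\<in>Pow {0..<d}. \<Sum>p\<in>?Pi. \<Sum>q\<in>?Pi. ?u W * (?g p W * ?g q W))"
    by (rule sum.swap)
  also have "\<dots> = (\<Sum>W\<in>Pow {0..<d}. ?u W * (real (card {p. p permutes {0..<d} \<and> p ` W \<subseteq> {0..<d} - L}))\<^sup>2)"
  proof (intro sum.cong refl)
    fix W
    have "(\<Sum>p\<in>?Pi. ?g p W) = real (card (?Pi \<inter> {p. p ` W \<subseteq> {0..<d} - L}))"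
      by (rule sum_of_bool_eq) (rule fin)+
    also have "?Pi \<inter> {p. p ` W \<subseteq> {0..<d} - L} = {p. p permutes {0..<d} \<and> p ` W \<subseteq> {0..<d} - L}"
      by auto
    finally have c: "(\<Sum>p\<in>?Pi. ?g p W) = real (card {p. p permutes {0..<d} \<and> p ` W \<subseteq> {0..<d} - L})" .
    have "(\<Sum>p\<in>?Pi. \<Sum>q\<in>?Pi. ?u W * (?g p W * ?g q W)) = ?u W * ((\<Sum>p\<in>?Pi. ?g p W) * (\<Sum>q\<in>?Pi. ?g q W))"
      unfolding sum_product by (simp only: sum_distrib_left)
    then show "(\<Sum>p\<in>?Pi. \<Sum>q\<in>?Pi. ?u W * (?g p W * ?g q W))
        = ?u W * (real (card {p. p permutes {0..<d} \<and> p ` W \<subseteq> {0..<d} - L}))\<^sup>2"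
      unfolding c by (simp only: power2_eq_square)
  qed
  finally show ?thesis .
qed

text \<open>Flipping signs of the diagonal entries of \<open>A\<close> can be absorbed into
  \<open>P\<close>, so all 2^d sign patterns give the same total. Adding them up brings in
  \<open>sum_sign_flips\<close>, whose factor 2^d cancels.\<close>

lemma sum_signed_perm_det:
  assumes A: "A \<in> carrier_mat d d" "diagonal_mat A"
    and B: "B \<in> carrier_mat d d" "diagonal_mat B"
  shows "(\<Sum>P\<in>signed_perm_mats d. \<Sum>S\<in>signed_perm_mats d.
      det (x \<cdot>\<^sub>m 1\<^sub>m d - (A + P * B * transpose_mat S) * transpose_mat (A + P * B * transpose_mat S)))
    = (\<Sum>L\<in>Pow {0..<d}. (-1) ^ card L * (\<Prod>i\<in>L. (A $$ (i, i))\<^sup>2) *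
        (\<Sum>P\<in>signed_perm_mats d. \<Sum>S\<in>signed_perm_mats d.
          row_det (d + d) (bordered d x (\<lambda>i j. (P * B * transpose_mat S) $$ (i, j))
            (\<lambda>i. if i \<in> {0..<d} then 0 else A $$ (i, i)) L)))"
proof -
  let ?S = "signed_perm_mats d"
  let ?a = "\<lambda>i. A $$ (i, i)"
  let ?C = "\<lambda>P S i j. (P * B * transpose_mat S) $$ (i, j)"
  let ?G = "\<lambda>P S a K. row_det (d + d) (bordered d x (?C P S) a K)"
  let ?f = "\<lambda>s i. if i \<in> s then - ?a i else ?a i"
  let ?z = "\<lambda>i. if i \<in> {0..<d} then 0 else ?a i"
  have carrier: "P \<in> carrier_mat d d" if "P \<in> ?S" for P
    using that by (simp add: signed_perm_mats_def)
  have "(\<Sum>P\<in>?S. \<Sum>S\<in>?S. ?G P S (?f s) {}) = (\<Sum>P\<in>?S. \<Sum>S\<in>?S. ?G P S ?a {})" for s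
  proof -
    have "?G P S (?f s) {} = ?G (flip_rows s P) S ?a {}" if "P \<in> ?S" "S \<in> ?S" for P S
      unfolding row_det_bordered_flip
    proof (rule row_det_bordered_cong)
      fix i j assume ij: "i < d" "j < d"
      have PB: "flip_rows s P * B \<in> carrier_mat d d" "P * B \<in> carrier_mat d d"
        using carrier[OF \<open>P \<in> ?S\<close>] B by (auto simp: flip_rows_def)
      have "(flip_rows s P * B) $$ (i, k) = flip_sign s i * (P * B) $$ (i, k)" if "k < d" for k
        using that ij carrier[OF \<open>P \<in> ?S\<close>] B
        by (simp add: scalar_prod_def flip_rows_def sum_distrib_left mult.assoc)
      then show "flip_sign s i * ?C P S i j = ?C (flip_rows s P) S i j"
        unfolding index_mult_transpose[OF PB(1) carrier[OF \<open>S \<in> ?S\<close>] ij]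
          index_mult_transpose[OF PB(2) carrier[OF \<open>S \<in> ?S\<close>] ij] sum_distrib_left
        by (intro sum.cong refl) simp
    qed
    then have "(\<Sum>P\<in>?S. \<Sum>S\<in>?S. ?G P S (?f s) {}) = (\<Sum>P\<in>?S. \<Sum>S\<in>?S. ?G (flip_rows s P) S ?a {})"
      by (intro sum.cong refl)
    also have "\<dots> = (\<Sum>P\<in>?S. \<Sum>S\<in>?S. ?G P S ?a {})"
      by (rule sum_flip_rows)
    finally show ?thesis .
  qed
  then have "2 ^ d * (\<Sum>P\<in>?S. \<Sum>S\<in>?S. ?G P S ?a {})
      = (\<Sum>s\<in>Pow {0..<d}. \<Sum>P\<in>?S. \<Sum>S\<in>?S. ?G P S (?f s) {})"
    by (simp add: card_Pow)
  also have "\<dots> = (\<Sum>P\<in>?S. \<Sum>s\<in>Pow {0..<d}. \<Sum>S\<in>?S. ?G P S (?f s) {})"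
    by (rule sum.swap)
  also have "\<dots> = (\<Sum>P\<in>?S. \<Sum>S\<in>?S. \<Sum>s\<in>Pow {0..<d}. ?G P S (?f s) {})"
    by (intro sum.cong refl sum.swap)
  also have "\<dots> = (\<Sum>P\<in>?S. \<Sum>S\<in>?S. 2 ^ d * (\<Sum>L\<in>Pow {0..<d}. (-1) ^ card L * (\<Prod>i\<in>L. (?a i)\<^sup>2) * ?G P S ?z L))"
  proof (intro sum.cong refl)
    fix P S
    show "(\<Sum>s\<in>Pow {0..<d}. ?G P S (?f s) {})
        = 2 ^ d * (\<Sum>L\<in>Pow {0..<d}. (-1) ^ card L * (\<Prod>i\<in>L. (?a i)\<^sup>2) * ?G P S ?z L)"
      using sum_sign_flips[of "{0..<d}" "?G P S" "{0..<d}" "{}" ?a]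
        row_det_bordered_even_part[of _ d _ x "?C P S"] by simp
  qed
  also have "\<dots> = 2 ^ d * (\<Sum>P\<in>?S. \<Sum>S\<in>?S. \<Sum>L\<in>Pow {0..<d}. (-1) ^ card L * (\<Prod>i\<in>L. (?a i)\<^sup>2) * ?G P S ?z L)"
    by (simp only: sum_distrib_left)
  also have "(\<Sum>P\<in>?S. \<Sum>S\<in>?S. \<Sum>L\<in>Pow {0..<d}. (-1) ^ card L * (\<Prod>i\<in>L. (?a i)\<^sup>2) * ?G P S ?z L)
      = (\<Sum>P\<in>?S. \<Sum>L\<in>Pow {0..<d}. \<Sum>S\<in>?S. (-1) ^ card L * (\<Prod>i\<in>L. (?a i)\<^sup>2) * ?G P S ?z L)"
    by (intro sum.cong refl sum.swap)
  also have "\<dots> = (\<Sum>L\<in>Pow {0..<d}. \<Sum>P\<in>?S. \<Sum>S\<in>?S. (-1) ^ card L * (\<Prod>i\<in>L. (?a i)\<^sup>2) * ?G P S ?z L)"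
    by (rule sum.swap)
  also have "\<dots> = (\<Sum>L\<in>Pow {0..<d}. (-1) ^ card L * (\<Prod>i\<in>L. (?a i)\<^sup>2) * (\<Sum>P\<in>?S. \<Sum>S\<in>?S. ?G P S ?z L))"
    by (simp only: sum_distrib_left)
  finally have "(\<Sum>P\<in>?S. \<Sum>S\<in>?S. ?G P S ?a {})
      = (\<Sum>L\<in>Pow {0..<d}. (-1) ^ card L * (\<Prod>i\<in>L. (?a i)\<^sup>2) * (\<Sum>P\<in>?S. \<Sum>S\<in>?S. ?G P S ?z L))"
    by simp
  moreover have "(\<Sum>P\<in>?S. \<Sum>S\<in>?S.
      det (x \<cdot>\<^sub>m 1\<^sub>m d - (A + P * B * transpose_mat S) * transpose_mat (A + P * B * transpose_mat S)))
      = (\<Sum>P\<in>?S. \<Sum>S\<in>?S. ?G P S ?a {})"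
  proof (intro sum.cong refl det_gram_bordered A)
    fix P S assume "P \<in> ?S" "S \<in> ?S"
    from this[THEN carrier] B(1) show "P * B * transpose_mat S \<in> carrier_mat d d"
      by simp
  qed
  ultimately show ?thesis by simp
qed

theorem theorem2p5:
  fixes A B :: "real mat" and d :: nat and x :: real
  assumes "A \<in> carrier_mat d d" and "diagonal_mat A"
    and "B \<in> carrier_mat d d" and "diagonal_mat B"
  shows "measure_pmf.expectation
           (pair_pmf (random_signed_perm_mat d) (random_signed_perm_mat d))
           (\<lambda>(P, S). det (x \<cdot>\<^sub>m 1\<^sub>m d
              - (A + P * B * transpose_mat S) * transpose_mat (A + P * B * transpose_mat S)))
         = (\<Sum>k = 0..d. x ^ (d - k) * (-1) ^ k *
              (\<Sum>(i, j) | i + j = k.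
                 ((fact (d - i) * fact (d - j)) / (fact (d - k) * fact d))\<^sup>2
                 * esum_minors i (A * transpose_mat A) * esum_minors j (B * transpose_mat B)))"
proof -
  let ?V = "{0..<d}"
  let ?E = "measure_pmf.expectation
           (pair_pmf (random_signed_perm_mat d) (random_signed_perm_mat d))
           (\<lambda>(P, S). det (x \<cdot>\<^sub>m 1\<^sub>m d
              - (A + P * B * transpose_mat S) * transpose_mat (A + P * B * transpose_mat S)))"
  let ?\<alpha> = "\<lambda>L. \<Prod>i\<in>L. (A $$ (i, i))\<^sup>2" and ?\<beta> = "\<lambda>W. \<Prod>i\<in>W. (B $$ (i, i))\<^sup>2"
  let ?e = "\<lambda>i. esum_minors i (A * transpose_mat A)" and ?e' = "\<lambda>j. esum_minors j (B * transpose_mat B)"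
  define N where "N L W = real (card {p. p permutes ?V \<and> p ` W \<subseteq> ?V - L})" for L W
  \<comment> \<open>The coefficient of the product of the two elementary sums. It is set to 0 for
    \<open>i + j > d\<close>, where the truncated \<open>d - (i + j)\<close> would give a wrong
    nonzero value.\<close>
  define h :: "nat \<Rightarrow> nat \<Rightarrow> real" where
    "h i j = (if i + j \<le> d then x ^ (d - (i + j)) * (-1) ^ (i + j) *
      ((fact (d - i) * fact (d - j)) / (fact (d - (i + j)) * fact d))\<^sup>2 else 0)" for i j
  \<comment> \<open>Dividing \<open>N L W\<close> by \<open>fact d\<close> gives the probability
    that a uniform permutation maps \<open>W\<close> into the complement of \<open>L\<close>; its
    square is the squared factor in \<open>h\<close>.\<close>
  have N: "(-1) ^ card L * ((-1) ^ card W * x ^ (d - card L - card W)) * (N L W)\<^sup>2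
      = (fact d)\<^sup>2 * h (card L) (card W)" if "L \<in> Pow ?V" "W \<in> Pow ?V" for L W
  proof -
    have "card L \<le> d" "card W \<le> d"
      using that card_mono[of ?V L] card_mono[of ?V W] by auto
    moreover have "card (?V - L) = d - card L"
      using that finite_subset[of L ?V] by (simp add: card_Diff_subset)
    ultimately have "N L W = (if card L + card W \<le> d
        then fact (d - card L) * fact (d - card W) / fact (d - (card L + card W)) else 0)"
      unfolding N_def using that card_permutations_image_subset[of ?V W "?V - L"] by auto
    then show ?thesis
      by (simp add: h_def power_add power_divide power_mult_distrib)
  qed
  have "?E * (fact d * 2 ^ d)\<^sup>2 = (\<Sum>L\<in>Pow ?V. (-1) ^ card L * ?\<alpha> L *
      ((2 ^ d)\<^sup>2 * (\<Sum>W\<in>Pow ?V. (-1) ^ card W * x ^ (d - card L - card W) * ?\<beta> W * (N L W)\<^sup>2)))"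
    unfolding expectation_random_signed_perm_pair sum_signed_perm_det[OF assms] N_def
    by (simp add: sum_signed_perm_bordered[OF assms(3,4)])
  also have "\<dots> = (\<Sum>L\<in>Pow ?V. \<Sum>W\<in>Pow ?V. (2 ^ d)\<^sup>2 * (fact d)\<^sup>2 * (h (card L) (card W) * (?\<alpha> L * ?\<beta> W)))"
    unfolding sum_distrib_left
  proof (intro sum.cong refl)
    fix L W assume LW: "L \<in> Pow ?V" "W \<in> Pow ?V"
    have "(-1) ^ card L * ?\<alpha> L * ((2 ^ d)\<^sup>2 * ((-1) ^ card W * x ^ (d - card L - card W) * ?\<beta> W * (N L W)\<^sup>2))
        = (2 ^ d)\<^sup>2 * (?\<alpha> L * ?\<beta> W) * ((-1) ^ card L * ((-1) ^ card W * x ^ (d - card L - card W)) * (N L W)\<^sup>2)"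
      by (simp only: mult_ac)
    then show "(-1) ^ card L * ?\<alpha> L * ((2 ^ d)\<^sup>2 * ((-1) ^ card W * x ^ (d - card L - card W) * ?\<beta> W * (N L W)\<^sup>2))
        = (2 ^ d)\<^sup>2 * (fact d)\<^sup>2 * (h (card L) (card W) * (?\<alpha> L * ?\<beta> W))"
      unfolding N[OF LW] by (simp only: mult_ac)
  qed
  also have "\<dots> = (\<Sum>L\<in>Pow ?V. \<Sum>W\<in>Pow ?V. h (card L) (card W) * (?\<alpha> L * ?\<beta> W)) * (fact d * 2 ^ d)\<^sup>2"
    by (simp add: sum_distrib_left[symmetric] power_mult_distrib)
  finally have "?E = (\<Sum>L\<in>Pow ?V. \<Sum>W\<in>Pow ?V. h (card L) (card W) * (?\<alpha> L * ?\<beta> W))"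
    by simp
  \<comment> \<open>The weight depends only on the sizes of \<open>L\<close> and \<open>W\<close>;
    grouping by size lets the sums of products become the coefficients \<open>?e i\<close> and
    \<open>?e' j\<close>.\<close>
  also have "\<dots> = (\<Sum>i = 0..d. \<Sum>L | L \<subseteq> ?V \<and> card L = i. \<Sum>j = 0..d. \<Sum>W | W \<subseteq> ?V \<and> card W = j.
      h (card L) (card W) * (?\<alpha> L * ?\<beta> W))"
    by (simp add: sum_Pow_by_card)
  also have "\<dots> = (\<Sum>i = 0..d. \<Sum>j = 0..d. \<Sum>L | L \<subseteq> ?V \<and> card L = i. \<Sum>W | W \<subseteq> ?V \<and> card W = j.
      h (card L) (card W) * (?\<alpha> L * ?\<beta> W))"
    by (intro sum.cong refl sum.swap)
  also have "\<dots> = (\<Sum>i = 0..d. \<Sum>j = 0..d. h i j * (?e i * ?e' j))"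
  proof (intro sum.cong refl)
    fix i j
    have "h i j * (?e i * ?e' j) = (\<Sum>L | L \<subseteq> ?V \<and> card L = i. \<Sum>W | W \<subseteq> ?V \<and> card W = j.
        h i j * (?\<alpha> L * ?\<beta> W))"
      unfolding esum_minors_diagonal_gram[OF assms(1,2)] esum_minors_diagonal_gram[OF assms(3,4)] sum_product
      by (simp only: sum_distrib_left)
    then show "(\<Sum>L | L \<subseteq> ?V \<and> card L = i. \<Sum>W | W \<subseteq> ?V \<and> card W = j.
        h (card L) (card W) * (?\<alpha> L * ?\<beta> W)) = h i j * (?e i * ?e' j)"
      by simp
  qed
  also have "\<dots> = (\<Sum>k = 0..d. \<Sum>(i, j) | i + j = k. h i j * (?e i * ?e' j))"
    by (rule sum_antidiagonals) (simp add: h_def)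
  also have "\<dots> = (\<Sum>k = 0..d. x ^ (d - k) * (-1) ^ k *
              (\<Sum>(i, j) | i + j = k.
                 ((fact (d - i) * fact (d - j)) / (fact (d - k) * fact d))\<^sup>2 * ?e i * ?e' j))"
    unfolding sum_distrib_left by (intro sum.cong refl) (auto simp: h_def)
  finally show ?thesis .
qed

end
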